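(* Let $\mathcal{E}$ be a cocomplete closed symmetric monoidal category with unit $I$, and let $(R,\mu,\eta)$ be a solid monoid in $\mathcal{E}$, with unit $\eta\colon I\to R$. Then the category of $R$-modules is equivalent to the full subcategory of $\mathcal{E}$ consisting of the $\eta$-local objects.
   Context: Let $\otimes$ and $\operatorname{Hom}_{\mathcal{E}}(-,-)$ be the tensor product and internal hom of $\mathcal{E}$. A monoid $(R,\mu,\eta)$ in $\mathcal{E}$ is solid if $\mu\colon R\otimes R\to R$ is an isomorphism. An $R$-module is an object $X$ with a morphism $R\otimes X\to X$ that is associative and unital; morphisms of $R$-modules are the morphisms compatible with the module structures. An object $Z$ of $\mathcal{E}$ is $\eta$-local if $\eta^*\colon\operatorname{Hom}_{\mathcal{E}}(R,Z)\to\operatorname{Hom}_{\mathcal{E}}(I,Z)$ is an isomorphism in $\mathcal{E}$. *)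

theory Defs
  imports Main "HOL-Library.Equipollence"
begin

section \<open>Categories, functors, equivalences\<close>

record ('o, 'a) cat =
  Obj :: "'o set"
  Arr :: "'a set"
  Dom :: "'a \<Rightarrow> 'o"
  Cod :: "'a \<Rightarrow> 'o"
  Ident :: "'o \<Rightarrow> 'a"  (\<open>\<one>\<index>\<close>)
  Comp :: "'a \<Rightarrow> 'a \<Rightarrow> 'a"  (infixl \<open>\<cdot>\<index>\<close> 65)

definition Hom :: "('o, 'a, 'm) cat_scheme \<Rightarrow> 'o \<Rightarrow> 'o \<Rightarrow> 'a set"
  where "Hom C X Y = {f \<in> Arr C. Dom C f = X \<and> Cod C f = Y}"

text \<open>\<open>g \<cdot> f\<close> is \<open>g\<close> after \<open>f\<close>. All operations are unspecified outside the carriers.\<close>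

locale category =
  fixes C :: "('o, 'a, 'm) cat_scheme" (structure)
  assumes Dom_Obj: "f \<in> Arr C \<Longrightarrow> Dom C f \<in> Obj C"
    and Cod_Obj: "f \<in> Arr C \<Longrightarrow> Cod C f \<in> Obj C"
    and Ident_Hom: "X \<in> Obj C \<Longrightarrow> \<one> X \<in> Hom C X X"
    and Comp_Hom: "\<lbrakk>f \<in> Hom C X Y; g \<in> Hom C Y Z\<rbrakk> \<Longrightarrow> g \<cdot> f \<in> Hom C X Z"
    and Comp_Ident: "f \<in> Hom C X Y \<Longrightarrow> f \<cdot> \<one> X = f"
    and Ident_Comp: "f \<in> Hom C X Y \<Longrightarrow> \<one> Y \<cdot> f = f"
    and Comp_assoc: "\<lbrakk>f \<in> Hom C W X; g \<in> Hom C X Y; h \<in> Hom C Y Z\<rbrakk>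
      \<Longrightarrow> (h \<cdot> g) \<cdot> f = h \<cdot> (g \<cdot> f)"

definition is_iso :: "('o, 'a, 'm) cat_scheme \<Rightarrow> 'o \<Rightarrow> 'o \<Rightarrow> 'a \<Rightarrow> bool"
  where "is_iso C X Y f \<longleftrightarrow> f \<in> Hom C X Y \<and>
    (\<exists>g \<in> Hom C Y X. g \<cdot>\<^bsub>C\<^esub> f = \<one>\<^bsub>C\<^esub> X \<and> f \<cdot>\<^bsub>C\<^esub> g = \<one>\<^bsub>C\<^esub> Y)"

locale is_functor =
  fixes C :: "('o, 'a, 'm) cat_scheme" and D :: "('p, 'b, 'n) cat_scheme"
    and Fo :: "'o \<Rightarrow> 'p" and Fa :: "'a \<Rightarrow> 'b"
  assumes obj: "X \<in> Obj C \<Longrightarrow> Fo X \<in> Obj D"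
    and arr: "f \<in> Hom C X Y \<Longrightarrow> Fa f \<in> Hom D (Fo X) (Fo Y)"
    and ident: "X \<in> Obj C \<Longrightarrow> Fa (\<one>\<^bsub>C\<^esub> X) = \<one>\<^bsub>D\<^esub> (Fo X)"
    and comp: "\<lbrakk>f \<in> Hom C X Y; g \<in> Hom C Y Z\<rbrakk> \<Longrightarrow> Fa (g \<cdot>\<^bsub>C\<^esub> f) = Fa g \<cdot>\<^bsub>D\<^esub> Fa f"

definition natural_iso ::
  "('o, 'a, 'm) cat_scheme \<Rightarrow> ('p, 'b, 'n) cat_scheme \<Rightarrow> ('o \<Rightarrow> 'p) \<Rightarrow> ('a \<Rightarrow> 'b) \<Rightarrow>
    ('o \<Rightarrow> 'p) \<Rightarrow> ('a \<Rightarrow> 'b) \<Rightarrow> ('o \<Rightarrow> 'b) \<Rightarrow> bool"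
  where "natural_iso C D Fo Fa Go Ga t \<longleftrightarrow>
    (\<forall>X \<in> Obj C. is_iso D (Fo X) (Go X) (t X)) \<and>
    (\<forall>X Y. \<forall>f \<in> Hom C X Y. t Y \<cdot>\<^bsub>D\<^esub> Fa f = Ga f \<cdot>\<^bsub>D\<^esub> t X)"

definition equivalent_categories ::
  "('o, 'a, 'm) cat_scheme \<Rightarrow> ('p, 'b, 'n) cat_scheme \<Rightarrow> bool"
  where "equivalent_categories C D \<longleftrightarrow> category C \<and> category D \<and>
    (\<exists>Fo Fa Go Ga u v. is_functor C D Fo Fa \<and> is_functor D C Go Ga \<and>
      natural_iso C C id id (Go \<circ> Fo) (Ga \<circ> Fa) u \<and>
      natural_iso D D (Fo \<circ> Go) (Fa \<circ> Ga) id id v)"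

definition full_subcategory :: "('o, 'a, 'm) cat_scheme \<Rightarrow> 'o set \<Rightarrow> ('o, 'a) cat"
  where "full_subcategory C S =
    \<lparr>Obj = Obj C \<inter> S, Arr = {f \<in> Arr C. Dom C f \<in> S \<and> Cod C f \<in> S},
     Dom = Dom C, Cod = Cod C, Ident = Ident C, Comp = Comp C\<rparr>"


section \<open>Small colimits\<close>

definition cocone :: "('i, 'j, 'k) cat_scheme \<Rightarrow> ('o, 'a, 'm) cat_scheme \<Rightarrow>
    ('i \<Rightarrow> 'o) \<Rightarrow> ('j \<Rightarrow> 'a) \<Rightarrow> 'o \<Rightarrow> ('i \<Rightarrow> 'a) \<Rightarrow> bool"
  where "cocone J C Do Da L \<iota> \<longleftrightarrow> L \<in> Obj C \<and>
    (\<forall>i \<in> Obj J. \<iota> i \<in> Hom C (Do i) L) \<and>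
    (\<forall>i j. \<forall>f \<in> Hom J i j. \<iota> j \<cdot>\<^bsub>C\<^esub> Da f = \<iota> i)"

definition colimit_cocone :: "('i, 'j, 'k) cat_scheme \<Rightarrow> ('o, 'a, 'm) cat_scheme \<Rightarrow>
    ('i \<Rightarrow> 'o) \<Rightarrow> ('j \<Rightarrow> 'a) \<Rightarrow> 'o \<Rightarrow> ('i \<Rightarrow> 'a) \<Rightarrow> bool"
  where "colimit_cocone J C Do Da L \<iota> \<longleftrightarrow> cocone J C Do Da L \<iota> \<and>
    (\<forall>M \<kappa>. cocone J C Do Da M \<kappa> \<longrightarrow>
      (\<exists>!h. h \<in> Hom C L M \<and> (\<forall>i \<in> Obj J. h \<cdot>\<^bsub>C\<^esub> \<iota> i = \<kappa> i)))"

text \<open>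
  The type \<open>'u\<close> plays the role of the universe of sets: a category is small if it has strictly
  fewer arrows (hence also strictly fewer objects) than \<open>'u\<close> has elements. Up to isomorphism
  the objects and arrows of such a category may be taken in \<open>'u\<close> itself. If the cardinality
  of \<open>'u\<close> is inaccessible, this is smallness with respect to the corresponding Grothendieck
  universe; no such assumption is made on \<open>'u\<close>.
\<close>

definition small_category :: "('u, 'u) cat \<Rightarrow> bool"
  where "small_category J \<longleftrightarrow> category J \<and> Arr J \<prec> (UNIV :: 'u set)"

definition cocomplete :: "'u itself \<Rightarrow> ('o, 'a, 'm) cat_scheme \<Rightarrow> bool"
  where "cocomplete U C \<longleftrightarrow>
    (\<forall>(J :: ('u, 'u) cat) Do Da. small_category J \<and> is_functor J C Do Da \<longrightarrow>
      (\<exists>L \<iota>. colimit_cocone J C Do Da L \<iota>))"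


section \<open>Closed symmetric monoidal categories\<close>

text \<open>
  Orientation of the structure morphisms: \<open>Assoc X Y Z : (X \<otimes> Y) \<otimes> Z \<rightarrow> X \<otimes> (Y \<otimes> Z)\<close>,
  \<open>LUnit X : I \<otimes> X \<rightarrow> X\<close>, \<open>RUnit X : X \<otimes> I \<rightarrow> X\<close>, \<open>Sym X Y : X \<otimes> Y \<rightarrow> Y \<otimes> X\<close>,
  \<open>Eval X Y : IHom X Y \<otimes> X \<rightarrow> Y\<close>. On objects the tensor product is written \<open>\<otimes>\<close>,
  on arrows \<open>\<boxtimes>\<close>.
\<close>

record ('o, 'a) monoidal_cat = "('o, 'a) cat" +
  Unit :: "'o"  (\<open>\<I>\<index>\<close>)
  TensorO :: "'o \<Rightarrow> 'o \<Rightarrow> 'o"  (infixr \<open>\<otimes>\<index>\<close> 70)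
  TensorA :: "'a \<Rightarrow> 'a \<Rightarrow> 'a"  (infixr \<open>\<boxtimes>\<index>\<close> 70)
  Assoc :: "'o \<Rightarrow> 'o \<Rightarrow> 'o \<Rightarrow> 'a"
  LUnit :: "'o \<Rightarrow> 'a"
  RUnit :: "'o \<Rightarrow> 'a"

record ('o, 'a) sym_monoidal_cat = "('o, 'a) monoidal_cat" +
  Sym :: "'o \<Rightarrow> 'o \<Rightarrow> 'a"

record ('o, 'a) closed_sym_monoidal_cat = "('o, 'a) sym_monoidal_cat" +
  IHom :: "'o \<Rightarrow> 'o \<Rightarrow> 'o"
  Eval :: "'o \<Rightarrow> 'o \<Rightarrow> 'a"

locale monoidal_category = category C
  for C :: "('o, 'a, 'm) monoidal_cat_scheme" (structure) +
  assumes Unit_Obj: "\<I> \<in> Obj C"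
    and Tensor_Obj: "\<lbrakk>X \<in> Obj C; Y \<in> Obj C\<rbrakk> \<Longrightarrow> X \<otimes> Y \<in> Obj C"
    and Tensor_Hom: "\<lbrakk>f \<in> Hom C X Y; g \<in> Hom C X' Y'\<rbrakk>
      \<Longrightarrow> f \<boxtimes> g \<in> Hom C (X \<otimes> X') (Y \<otimes> Y')"
    and Tensor_Ident: "\<lbrakk>X \<in> Obj C; Y \<in> Obj C\<rbrakk> \<Longrightarrow> \<one> X \<boxtimes> \<one> Y = \<one> (X \<otimes> Y)"
    and Tensor_Comp: "\<lbrakk>f \<in> Hom C X Y; g \<in> Hom C Y Z; f' \<in> Hom C X' Y'; g' \<in> Hom C Y' Z'\<rbrakk>
      \<Longrightarrow> (g \<cdot> f) \<boxtimes> (g' \<cdot> f') = (g \<boxtimes> g') \<cdot> (f \<boxtimes> f')"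
    and Assoc_iso: "\<lbrakk>X \<in> Obj C; Y \<in> Obj C; Z \<in> Obj C\<rbrakk>
      \<Longrightarrow> is_iso C ((X \<otimes> Y) \<otimes> Z) (X \<otimes> (Y \<otimes> Z)) (Assoc C X Y Z)"
    and Assoc_natural: "\<lbrakk>f \<in> Hom C X X'; g \<in> Hom C Y Y'; h \<in> Hom C Z Z'\<rbrakk>
      \<Longrightarrow> Assoc C X' Y' Z' \<cdot> ((f \<boxtimes> g) \<boxtimes> h) = (f \<boxtimes> (g \<boxtimes> h)) \<cdot> Assoc C X Y Z"
    and LUnit_iso: "X \<in> Obj C \<Longrightarrow> is_iso C (\<I> \<otimes> X) X (LUnit C X)"
    and LUnit_natural: "f \<in> Hom C X Y \<Longrightarrow> LUnit C Y \<cdot> (\<one> \<I> \<boxtimes> f) = f \<cdot> LUnit C X"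
    and RUnit_iso: "X \<in> Obj C \<Longrightarrow> is_iso C (X \<otimes> \<I>) X (RUnit C X)"
    and RUnit_natural: "f \<in> Hom C X Y \<Longrightarrow> RUnit C Y \<cdot> (f \<boxtimes> \<one> \<I>) = f \<cdot> RUnit C X"
    and pentagon: "\<lbrakk>W \<in> Obj C; X \<in> Obj C; Y \<in> Obj C; Z \<in> Obj C\<rbrakk>
      \<Longrightarrow> Assoc C W X (Y \<otimes> Z) \<cdot> Assoc C (W \<otimes> X) Y Z =
          (\<one> W \<boxtimes> Assoc C X Y Z) \<cdot> Assoc C W (X \<otimes> Y) Z \<cdot> (Assoc C W X Y \<boxtimes> \<one> Z)"
    and triangle: "\<lbrakk>X \<in> Obj C; Y \<in> Obj C\<rbrakk>
      \<Longrightarrow> (\<one> X \<boxtimes> LUnit C Y) \<cdot> Assoc C X \<I> Y = RUnit C X \<boxtimes> \<one> Y"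

locale symmetric_monoidal_category = monoidal_category C
  for C :: "('o, 'a, 'm) sym_monoidal_cat_scheme" (structure) +
  assumes Sym_Hom: "\<lbrakk>X \<in> Obj C; Y \<in> Obj C\<rbrakk> \<Longrightarrow> Sym C X Y \<in> Hom C (X \<otimes> Y) (Y \<otimes> X)"
    and Sym_natural: "\<lbrakk>f \<in> Hom C X X'; g \<in> Hom C Y Y'\<rbrakk>
      \<Longrightarrow> Sym C X' Y' \<cdot> (f \<boxtimes> g) = (g \<boxtimes> f) \<cdot> Sym C X Y"
    and Sym_Sym: "\<lbrakk>X \<in> Obj C; Y \<in> Obj C\<rbrakk> \<Longrightarrow> Sym C Y X \<cdot> Sym C X Y = \<one> (X \<otimes> Y)"
    and hexagon: "\<lbrakk>X \<in> Obj C; Y \<in> Obj C; Z \<in> Obj C\<rbrakk>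
      \<Longrightarrow> Assoc C Y Z X \<cdot> Sym C X (Y \<otimes> Z) \<cdot> Assoc C X Y Z =
          (\<one> Y \<boxtimes> Sym C X Z) \<cdot> Assoc C Y X Z \<cdot> (Sym C X Y \<boxtimes> \<one> Z)"

text \<open>The last axiom says that \<open>IHom X\<close> is right adjoint to \<open>- \<otimes> X\<close>, with counit \<open>Eval X\<close>.\<close>

locale closed_symmetric_monoidal_category = symmetric_monoidal_category C
  for C :: "('o, 'a, 'm) closed_sym_monoidal_cat_scheme" (structure) +
  assumes IHom_Obj: "\<lbrakk>X \<in> Obj C; Y \<in> Obj C\<rbrakk> \<Longrightarrow> IHom C X Y \<in> Obj C"
    and Eval_Hom: "\<lbrakk>X \<in> Obj C; Y \<in> Obj C\<rbrakk> \<Longrightarrow> Eval C X Y \<in> Hom C (IHom C X Y \<otimes> X) Y"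
    and Eval_universal: "\<lbrakk>A \<in> Obj C; X \<in> Obj C; Y \<in> Obj C; f \<in> Hom C (A \<otimes> X) Y\<rbrakk>
      \<Longrightarrow> \<exists>!g. g \<in> Hom C A (IHom C X Y) \<and> Eval C X Y \<cdot> (g \<boxtimes> \<one> X) = f"

text \<open>The transpose \<open>A \<rightarrow> IHom X Y\<close> of \<open>f : A \<otimes> X \<rightarrow> Y\<close>.\<close>

definition Curry :: "('o, 'a, 'm) closed_sym_monoidal_cat_scheme \<Rightarrow> 'o \<Rightarrow> 'o \<Rightarrow> 'o \<Rightarrow> 'a \<Rightarrow> 'a"
  where "Curry C A X Y f =
    (THE g. g \<in> Hom C A (IHom C X Y) \<and> Eval C X Y \<cdot>\<^bsub>C\<^esub> (g \<boxtimes>\<^bsub>C\<^esub> \<one>\<^bsub>C\<^esub> X) = f)"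

text \<open>For \<open>h : X \<rightarrow> Y\<close>, the induced morphism \<open>h\<^sup>* : IHom Y Z \<rightarrow> IHom X Z\<close>.\<close>

definition IHom_precomp :: "('o, 'a, 'm) closed_sym_monoidal_cat_scheme \<Rightarrow> 'a \<Rightarrow> 'o \<Rightarrow> 'a"
  where "IHom_precomp C h Z =
    Curry C (IHom C (Cod C h) Z) (Dom C h) Z
      (Eval C (Cod C h) Z \<cdot>\<^bsub>C\<^esub> (\<one>\<^bsub>C\<^esub> (IHom C (Cod C h) Z) \<boxtimes>\<^bsub>C\<^esub> h))"


section \<open>Monoids, modules and local objects\<close>

locale monoid_in = monoidal_category C
  for C :: "('o, 'a, 'm) monoidal_cat_scheme" (structure)
    and R :: 'o and \<mu> :: 'a and \<eta> :: 'a +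
  assumes R_Obj: "R \<in> Obj C"
    and mult_Hom: "\<mu> \<in> Hom C (R \<otimes> R) R"
    and unit_Hom: "\<eta> \<in> Hom C \<I> R"
    and mult_assoc: "\<mu> \<cdot> (\<mu> \<boxtimes> \<one> R) = \<mu> \<cdot> (\<one> R \<boxtimes> \<mu>) \<cdot> Assoc C R R R"
    and mult_unit_left: "\<mu> \<cdot> (\<eta> \<boxtimes> \<one> R) = LUnit C R"
    and mult_unit_right: "\<mu> \<cdot> (\<one> R \<boxtimes> \<eta>) = RUnit C R"

locale solid_monoid_in = monoid_in C R \<mu> \<eta>
  for C :: "('o, 'a, 'm) monoidal_cat_scheme" (structure)
    and R :: 'o and \<mu> :: 'a and \<eta> :: 'a +
  assumes mult_iso: "is_iso C (R \<otimes> R) R \<mu>"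

text \<open>A module is the pair \<open>(X, a)\<close> of its underlying object and its action \<open>a : R \<otimes> X \<rightarrow> X\<close>.\<close>

definition Modules :: "('o, 'a, 'm) monoidal_cat_scheme \<Rightarrow> 'o \<Rightarrow> 'a \<Rightarrow> 'a \<Rightarrow> ('o \<times> 'a) set"
  where "Modules C R \<mu> \<eta> = {(X, a). X \<in> Obj C \<and> a \<in> Hom C (R \<otimes>\<^bsub>C\<^esub> X) X \<and>
    a \<cdot>\<^bsub>C\<^esub> (\<mu> \<boxtimes>\<^bsub>C\<^esub> \<one>\<^bsub>C\<^esub> X) = a \<cdot>\<^bsub>C\<^esub> (\<one>\<^bsub>C\<^esub> R \<boxtimes>\<^bsub>C\<^esub> a) \<cdot>\<^bsub>C\<^esub> Assoc C R R X \<and>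
    a \<cdot>\<^bsub>C\<^esub> (\<eta> \<boxtimes>\<^bsub>C\<^esub> \<one>\<^bsub>C\<^esub> X) = LUnit C X}"

definition module_hom :: "('o, 'a, 'm) monoidal_cat_scheme \<Rightarrow> 'o \<Rightarrow> 'o \<times> 'a \<Rightarrow> 'o \<times> 'a \<Rightarrow> 'a \<Rightarrow> bool"
  where "module_hom C R M N f \<longleftrightarrow> f \<in> Hom C (fst M) (fst N) \<and>
    f \<cdot>\<^bsub>C\<^esub> snd M = snd N \<cdot>\<^bsub>C\<^esub> (\<one>\<^bsub>C\<^esub> R \<boxtimes>\<^bsub>C\<^esub> f)"

text \<open>
  A morphism is a triple \<open>(M, f, N)\<close> recording its source and target modules, since the
  underlying arrow \<open>f\<close> does not determine the actions on its domain and codomain.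
\<close>

definition module_category :: "('o, 'a, 'm) monoidal_cat_scheme \<Rightarrow> 'o \<Rightarrow> 'a \<Rightarrow> 'a \<Rightarrow>
    ('o \<times> 'a, ('o \<times> 'a) \<times> 'a \<times> ('o \<times> 'a)) cat"
  where "module_category C R \<mu> \<eta> =
    \<lparr>Obj = Modules C R \<mu> \<eta>,
     Arr = {(M, f, N). M \<in> Modules C R \<mu> \<eta> \<and> N \<in> Modules C R \<mu> \<eta> \<and> module_hom C R M N f},
     Dom = (\<lambda>(M, f, N). M),
     Cod = (\<lambda>(M, f, N). N),
     Ident = (\<lambda>M. (M, \<one>\<^bsub>C\<^esub> (fst M), M)),
     Comp = (\<lambda>(N, g, P) (M, f, N'). (M, g \<cdot>\<^bsub>C\<^esub> f, P))\<rparr>"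

definition local_objects :: "('o, 'a, 'm) closed_sym_monoidal_cat_scheme \<Rightarrow> 'a \<Rightarrow> 'o set"
  where "local_objects C h = {Z \<in> Obj C.
    is_iso C (IHom C (Cod C h) Z) (IHom C (Dom C h) Z) (IHom_precomp C h Z)}"

end

theory Submission
  imports Defs
begin

text \<open>
  The forgetful functor from \<open>R\<close>-modules to the ambient category is fully faithful, and its image
  on objects consists exactly of the \<open>\<eta>\<close>-local objects.

  By the tensor-hom adjunction and the Yoneda lemma, \<open>Z\<close> is local iff for every \<open>A\<close> each morphism
  \<open>A \<otimes> I \<rightarrow> Z\<close> extends uniquely along \<open>A \<otimes> \<eta>\<close> (\<open>local_objects_iff_orthogonal\<close>). This
  orthogonality condition mentions only the tensor product and is compared with the existence of an
  action.

  Up to unitors and symmetries, an action on \<open>Z\<close> retracts \<open>\<eta> \<otimes> Z\<close>, so a morphism \<open>f : A \<rightarrow> Z\<close> extends to \<open>A \<otimes> R\<close> as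
  \<open>f \<otimes> R\<close> followed by the action. Uniqueness of the extension is where solidity enters: since
  \<open>\<mu>\<close> is monic, the two maps \<open>\<eta> \<otimes> R\<close> and \<open>R \<otimes> \<eta>\<close> agree up to unitors, so that the value of
  \<open>g : A \<otimes> R \<rightarrow> Z\<close> can be read off from its restriction to \<open>A \<otimes> I\<close>
  (\<open>orthogonal_if_unital_action\<close>).
  Conversely, if \<open>Z\<close> is orthogonal, then the left unitor of \<open>Z\<close> extends along \<open>\<eta> \<otimes> Z\<close> to a
  unital action, and uniqueness of extensions makes it associative (\<open>orthogonal_imp_action\<close>).

  Uniqueness of extensions also makes every morphism between the carriers of two modules linear
  (\<open>module_hom_iff_Hom\<close>), which gives fullness; faithfulness is clear.
\<close>


section \<open>Composition and tensor calculus\<close>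

context category
begin

lemma Hom_iff: "f \<in> Hom C X Y \<longleftrightarrow> f \<in> Arr C \<and> Dom C f = X \<and> Cod C f = Y"
  by (simp add: Hom_def)

lemma Hom_Obj: "f \<in> Hom C X Y \<Longrightarrow> X \<in> Obj C" "f \<in> Hom C X Y \<Longrightarrow> Y \<in> Obj C"
  using Dom_Obj Cod_Obj by (auto simp: Hom_iff)

lemma Ident_arr [simp]:
  "X \<in> Obj C \<Longrightarrow> \<one> X \<in> Arr C" "X \<in> Obj C \<Longrightarrow> Dom C (\<one> X) = X" "X \<in> Obj C \<Longrightarrow> Cod C (\<one> X) = X"
  using Ident_Hom by (auto simp: Hom_iff)

lemma Comp_arr [simp]:
  assumes "f \<in> Arr C" "g \<in> Arr C" "Dom C g = Cod C f"
  shows "g \<cdot> f \<in> Arr C" "Dom C (g \<cdot> f) = Dom C f" "Cod C (g \<cdot> f) = Cod C g"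
  using Comp_Hom[of f "Dom C f" "Cod C f" g "Cod C g"] assms by (auto simp: Hom_iff)

lemma Comp_assoc_arr [simp]:
  assumes "f \<in> Arr C" "g \<in> Arr C" "h \<in> Arr C" "Dom C g = Cod C f" "Dom C h = Cod C g"
  shows "(h \<cdot> g) \<cdot> f = h \<cdot> (g \<cdot> f)"
  using assms by (intro Comp_assoc) (auto simp: Hom_iff)

lemma Ident_Comp_arr [simp]:
  "f \<in> Arr C \<Longrightarrow> Dom C f = X \<Longrightarrow> f \<cdot> \<one> X = f"
  "f \<in> Arr C \<Longrightarrow> Cod C f = Y \<Longrightarrow> \<one> Y \<cdot> f = f"
  using Comp_Ident Ident_Comp by (auto simp: Hom_iff)

lemma is_isoE:
  assumes "is_iso C X Y f"
  obtains g where "f \<in> Hom C X Y" "g \<in> Hom C Y X" "g \<cdot> f = \<one> X" "f \<cdot> g = \<one> Y"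
  using assms unfolding is_iso_def by blast

lemma is_iso_Hom: "is_iso C X Y f \<Longrightarrow> f \<in> Hom C X Y"
  by (simp add: is_iso_def)

lemma iso_cancel_right:
  assumes "is_iso C X Y f" "g \<in> Hom C Y Z" "h \<in> Hom C Y Z" "g \<cdot> f = h \<cdot> f"
  shows "g = h"
proof -
  obtain k where k: "f \<in> Hom C X Y" "k \<in> Hom C Y X" "f \<cdot> k = \<one> Y"
    using assms(1) by (elim is_isoE)
  have "g = (g \<cdot> f) \<cdot> k" "h = (h \<cdot> f) \<cdot> k"
    using k assms(2,3) by (simp_all add: Hom_iff)
  then show ?thesis using assms(4) by simp
qed

lemma iso_cancel_left:
  assumes "is_iso C X Y f" "g \<in> Hom C W X" "h \<in> Hom C W X" "f \<cdot> g = f \<cdot> h"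
  shows "g = h"
proof -
  obtain k where k: "f \<in> Hom C X Y" "k \<in> Hom C Y X" "k \<cdot> f = \<one> X"
    using assms(1) by (elim is_isoE)
  have "g = k \<cdot> (f \<cdot> g)" "h = k \<cdot> (f \<cdot> h)"
    using k assms(2,3) by (simp_all add: Hom_iff flip: Comp_assoc_arr)
  then show ?thesis using assms(4) by simp
qed

lemma is_iso_Comp:
  assumes "is_iso C X Y f" "is_iso C Y Z g"
  shows "is_iso C X Z (g \<cdot> f)"
proof -
  obtain f' where f: "f \<in> Hom C X Y" "f' \<in> Hom C Y X" "f' \<cdot> f = \<one> X" "f \<cdot> f' = \<one> Y"
    using assms(1) by (elim is_isoE)
  obtain g' where g: "g \<in> Hom C Y Z" "g' \<in> Hom C Z Y" "g' \<cdot> g = \<one> Y" "g \<cdot> g' = \<one> Z"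
    using assms(2) by (elim is_isoE)
  have "(f' \<cdot> g') \<cdot> (g \<cdot> f) = f' \<cdot> ((g' \<cdot> g) \<cdot> f)" "(g \<cdot> f) \<cdot> (f' \<cdot> g') = g \<cdot> ((f \<cdot> f') \<cdot> g')"
    using f(1,2) g(1,2) by (simp_all add: Hom_iff)
  moreover have "f' \<cdot> ((g' \<cdot> g) \<cdot> f) = \<one> X" "g \<cdot> ((f \<cdot> f') \<cdot> g') = \<one> Z"
    unfolding f(4) g(3) using f g by (simp_all add: Hom_iff)
  ultimately show ?thesis
    unfolding is_iso_def using f(1,2) g(1,2) by (metis Comp_Hom)
qed

lemma category_full_subcategory: "category (full_subcategory C S)"
  by unfold_locales (auto simp: full_subcategory_def Hom_def Dom_Obj Cod_Obj)

end

context monoidal_category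
begin

declare Unit_Obj [simp] Tensor_Obj [simp] Tensor_Ident [simp]

lemma Tensor_arr [simp]:
  assumes "f \<in> Arr C" "g \<in> Arr C"
  shows "f \<boxtimes> g \<in> Arr C" "Dom C (f \<boxtimes> g) = Dom C f \<otimes> Dom C g" "Cod C (f \<boxtimes> g) = Cod C f \<otimes> Cod C g"
  using Tensor_Hom[of f "Dom C f" "Cod C f" g "Dom C g" "Cod C g"] assms by (auto simp: Hom_iff)

lemma Tensor_Comp_arr [simp]:
  assumes "f \<in> Arr C" "g \<in> Arr C" "f' \<in> Arr C" "g' \<in> Arr C"
    and "Dom C g = Cod C f" "Dom C g' = Cod C f'"
  shows "(g \<boxtimes> g') \<cdot> (f \<boxtimes> f') = (g \<cdot> f) \<boxtimes> (g' \<cdot> f')"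
  using Tensor_Comp[of f "Dom C f" "Cod C f" g "Cod C g" f' "Dom C f'" "Cod C f'" g' "Cod C g'"] assms
  by (simp add: Hom_iff)

lemma Tensor_Comp_arr' [simp]:
  assumes "f \<in> Arr C" "g \<in> Arr C" "f' \<in> Arr C" "g' \<in> Arr C" "k \<in> Arr C"
    and "Dom C g = Cod C f" "Dom C g' = Cod C f'" "Cod C k = Dom C f \<otimes> Dom C f'"
  shows "(g \<boxtimes> g') \<cdot> ((f \<boxtimes> f') \<cdot> k) = ((g \<cdot> f) \<boxtimes> (g' \<cdot> f')) \<cdot> k"
  using assms by (simp flip: Comp_assoc_arr)

lemma Assoc_arr [simp]:
  assumes "X \<in> Obj C" "Y \<in> Obj C" "Z \<in> Obj C"
  shows "Assoc C X Y Z \<in> Arr C" "Dom C (Assoc C X Y Z) = (X \<otimes> Y) \<otimes> Z"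
    "Cod C (Assoc C X Y Z) = X \<otimes> Y \<otimes> Z"
  using is_iso_Hom[OF Assoc_iso[OF assms]] by (auto simp: Hom_iff)

lemma LUnit_arr [simp]:
  assumes "X \<in> Obj C"
  shows "LUnit C X \<in> Arr C" "Dom C (LUnit C X) = \<I> \<otimes> X" "Cod C (LUnit C X) = X"
  using is_iso_Hom[OF LUnit_iso[OF assms]] by (auto simp: Hom_iff)

lemma RUnit_arr [simp]:
  assumes "X \<in> Obj C"
  shows "RUnit C X \<in> Arr C" "Dom C (RUnit C X) = X \<otimes> \<I>" "Cod C (RUnit C X) = X"
  using is_iso_Hom[OF RUnit_iso[OF assms]] by (auto simp: Hom_iff)

lemma is_iso_Tensor_Ident:
  assumes "is_iso C X Y f" "Z \<in> Obj C"
  shows "is_iso C (X \<otimes> Z) (Y \<otimes> Z) (f \<boxtimes> \<one> Z)"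
proof -
  obtain g where g: "f \<in> Hom C X Y" "g \<in> Hom C Y X" "g \<cdot> f = \<one> X" "f \<cdot> g = \<one> Y"
    using assms(1) by (elim is_isoE)
  show ?thesis
    unfolding is_iso_def
    using g assms(2) Hom_Obj[OF g(1)]
    by (auto simp: Hom_iff intro!: bexI[of _ "g \<boxtimes> \<one> Z"])
qed

lemma Unit_Tensor_cancel:
  assumes "f \<in> Hom C X Y" "g \<in> Hom C X Y" "\<one> \<I> \<boxtimes> f = \<one> \<I> \<boxtimes> g"
  shows "f = g"
  by (metis assms LUnit_natural LUnit_iso Hom_Obj(1) iso_cancel_right)

text \<open>
  Kelly's consequence of the pentagon and the triangle. Since \<open>\<I> \<otimes> -\<close> is faithful and the
  associators are isomorphisms, it suffices to compare the two sides after tensoring with \<open>\<I>\<close> and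
  precomposing with two associators; the pentagon and two triangles then reduce both of them to
  the right unitor of \<open>\<I>\<close>.
\<close>

lemma LUnit_Tensor:
  assumes X: "X \<in> Obj C" and Y: "Y \<in> Obj C"
  shows "LUnit C (X \<otimes> Y) \<cdot> Assoc C \<I> X Y = LUnit C X \<boxtimes> \<one> Y"
proof (rule Unit_Tensor_cancel)
  let ?p = "Assoc C \<I> (\<I> \<otimes> X) Y \<cdot> (Assoc C \<I> \<I> X \<boxtimes> \<one> Y)"
  have p: "is_iso C (((\<I> \<otimes> \<I>) \<otimes> X) \<otimes> Y) (\<I> \<otimes> (\<I> \<otimes> X) \<otimes> Y) ?p"
    using X Y by (intro is_iso_Comp[OF is_iso_Tensor_Ident Assoc_iso] Assoc_iso) simp_all
  have "(\<one> \<I> \<boxtimes> (LUnit C (X \<otimes> Y) \<cdot> Assoc C \<I> X Y)) \<cdot> ?p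
      = (\<one> \<I> \<boxtimes> LUnit C (X \<otimes> Y)) \<cdot> ((\<one> \<I> \<boxtimes> Assoc C \<I> X Y) \<cdot> ?p)"
    using X Y by simp
  also have "\<dots> = (\<one> \<I> \<boxtimes> LUnit C (X \<otimes> Y)) \<cdot> (Assoc C \<I> \<I> (X \<otimes> Y) \<cdot> Assoc C (\<I> \<otimes> \<I>) X Y)"
    using X Y pentagon[of \<I> \<I> X Y] by simp
  also have "\<dots> = (RUnit C \<I> \<boxtimes> \<one> (X \<otimes> Y)) \<cdot> Assoc C (\<I> \<otimes> \<I>) X Y"
    using X Y triangle[of \<I> "X \<otimes> Y"] by (simp flip: Comp_assoc_arr)
  also have "\<dots> = Assoc C \<I> X Y \<cdot> ((RUnit C \<I> \<boxtimes> \<one> X) \<boxtimes> \<one> Y)"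
    using X Y Assoc_natural[of "RUnit C \<I>" "\<I> \<otimes> \<I>" \<I> "\<one> X" X X "\<one> Y" Y Y] by (simp add: Hom_iff)
  also have "\<dots> = Assoc C \<I> X Y \<cdot> ((\<one> \<I> \<boxtimes> LUnit C X) \<boxtimes> \<one> Y) \<cdot> (Assoc C \<I> \<I> X \<boxtimes> \<one> Y)"
    using X Y triangle[of \<I> X] by simp
  also have "\<dots> = (\<one> \<I> \<boxtimes> (LUnit C X \<boxtimes> \<one> Y)) \<cdot> ?p"
    using X Y Assoc_natural[of "\<one> \<I>" \<I> \<I> "LUnit C X" "\<I> \<otimes> X" X "\<one> Y" Y Y]
    by (simp add: Hom_iff flip: Comp_assoc_arr)
  finally show "\<one> \<I> \<boxtimes> (LUnit C (X \<otimes> Y) \<cdot> Assoc C \<I> X Y) = \<one> \<I> \<boxtimes> (LUnit C X \<boxtimes> \<one> Y)"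
    by (rule iso_cancel_right[OF p, rotated 2]) (use X Y in \<open>simp_all add: Hom_iff\<close>)
qed (use X Y in \<open>simp_all add: Hom_iff\<close>)

end

context symmetric_monoidal_category
begin

lemma Sym_arr [simp]:
  assumes "X \<in> Obj C" "Y \<in> Obj C"
  shows "Sym C X Y \<in> Arr C" "Dom C (Sym C X Y) = X \<otimes> Y" "Cod C (Sym C X Y) = Y \<otimes> X"
  using Sym_Hom[OF assms] by (auto simp: Hom_iff)

lemma Sym_iso: "X \<in> Obj C \<Longrightarrow> Y \<in> Obj C \<Longrightarrow> is_iso C (X \<otimes> Y) (Y \<otimes> X) (Sym C X Y)"
  unfolding is_iso_def using Sym_Hom Sym_Sym by blast

text \<open>
  This composite is the right unitor, but only its naturality and invertibility are used below.
  Both are immediate from its definition, whereas its agreement with \<open>RUnit\<close> is a further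
  coherence argument.
\<close>

definition SUnit :: "'o \<Rightarrow> 'a"
  where "SUnit X = LUnit C X \<cdot> Sym C X \<I>"

lemma SUnit_arr [simp]:
  assumes "X \<in> Obj C"
  shows "SUnit X \<in> Arr C" "Dom C (SUnit X) = X \<otimes> \<I>" "Cod C (SUnit X) = X"
  using assms by (simp_all add: SUnit_def)

lemma SUnit_iso: "X \<in> Obj C \<Longrightarrow> is_iso C (X \<otimes> \<I>) X (SUnit X)"
  unfolding SUnit_def by (rule is_iso_Comp[OF Sym_iso LUnit_iso]) simp_all

lemma SUnit_natural:
  assumes f: "f \<in> Hom C X Y"
  shows "SUnit Y \<cdot> (f \<boxtimes> \<one> \<I>) = f \<cdot> SUnit X"
proof -
  have o: "X \<in> Obj C" "Y \<in> Obj C" using Hom_Obj[OF f] .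
  have "SUnit Y \<cdot> (f \<boxtimes> \<one> \<I>) = LUnit C Y \<cdot> (Sym C Y \<I> \<cdot> (f \<boxtimes> \<one> \<I>))"
    using f o by (simp add: SUnit_def Hom_iff)
  also have "\<dots> = (LUnit C Y \<cdot> (\<one> \<I> \<boxtimes> f)) \<cdot> Sym C X \<I>"
    using f o Sym_natural[OF f Ident_Hom[OF Unit_Obj]] by (simp add: Hom_iff)
  also have "\<dots> = f \<cdot> SUnit X"
    using f o LUnit_natural[OF f] by (simp add: Hom_iff SUnit_def)
  finally show ?thesis .
qed

end


section \<open>Locality as an orthogonality condition\<close>

text \<open>
  Orthogonality in the enriched sense: it is tested against \<open>A \<otimes> h\<close> for all \<open>A\<close>, which lets it
  describe an isomorphism of internal homs and not merely of hom-sets.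
\<close>

definition orthogonal :: "('o, 'a, 'm) monoidal_cat_scheme \<Rightarrow> 'a \<Rightarrow> 'o \<Rightarrow> bool"
  where "orthogonal C h Z \<longleftrightarrow> Z \<in> Obj C \<and>
    (\<forall>A \<in> Obj C. \<forall>f \<in> Hom C (A \<otimes>\<^bsub>C\<^esub> Dom C h) Z.
      \<exists>!g. g \<in> Hom C (A \<otimes>\<^bsub>C\<^esub> Cod C h) Z \<and> g \<cdot>\<^bsub>C\<^esub> (\<one>\<^bsub>C\<^esub> A \<boxtimes>\<^bsub>C\<^esub> h) = f)"

context closed_symmetric_monoidal_category
begin

declare IHom_Obj [simp]

lemma Eval_arr [simp]:
  assumes "X \<in> Obj C" "Y \<in> Obj C"
  shows "Eval C X Y \<in> Arr C" "Dom C (Eval C X Y) = IHom C X Y \<otimes> X" "Cod C (Eval C X Y) = Y"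
  using Eval_Hom[OF assms] by (auto simp: Hom_iff)

lemma Curry_transpose:
  assumes "A \<in> Obj C" "X \<in> Obj C" "f \<in> Hom C (A \<otimes> X) Y"
  shows "Curry C A X Y f \<in> Hom C A (IHom C X Y)" "Eval C X Y \<cdot> (Curry C A X Y f \<boxtimes> \<one> X) = f"
  using theI'[OF Eval_universal[OF assms(1,2) Hom_Obj(2)[OF assms(3)] assms(3)]]
  unfolding Curry_def by auto

lemma Eval_cancel:
  assumes "X \<in> Obj C" "Y \<in> Obj C" "g \<in> Hom C A (IHom C X Y)" "g' \<in> Hom C A (IHom C X Y)"
    and "Eval C X Y \<cdot> (g \<boxtimes> \<one> X) = Eval C X Y \<cdot> (g' \<boxtimes> \<one> X)"
  shows "g = g'"
proof -
  have A: "A \<in> Obj C" using assms(3) by (rule Hom_Obj)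
  have "Eval C X Y \<cdot> (g \<boxtimes> \<one> X) \<in> Hom C (A \<otimes> X) Y"
    using assms(1-3) A by (simp add: Hom_iff)
  from Eval_universal[OF A assms(1,2) this] show ?thesis
    using assms(3-5) by metis
qed

lemma IHom_precomp_Hom:
  assumes "h \<in> Hom C X Y" "Z \<in> Obj C"
  shows "IHom_precomp C h Z \<in> Hom C (IHom C Y Z) (IHom C X Z)"
    and "Eval C X Z \<cdot> (IHom_precomp C h Z \<boxtimes> \<one> X) = Eval C Y Z \<cdot> (\<one> (IHom C Y Z) \<boxtimes> h)"
proof -
  have o: "X \<in> Obj C" "Y \<in> Obj C" using Hom_Obj[OF assms(1)] .
  have "Eval C Y Z \<cdot> (\<one> (IHom C Y Z) \<boxtimes> h) \<in> Hom C (IHom C Y Z \<otimes> X) Z"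
    using assms o by (simp add: Hom_iff)
  from Curry_transpose[OF _ o(1) this]
  show "IHom_precomp C h Z \<in> Hom C (IHom C Y Z) (IHom C X Z)"
    and "Eval C X Z \<cdot> (IHom_precomp C h Z \<boxtimes> \<one> X) = Eval C Y Z \<cdot> (\<one> (IHom C Y Z) \<boxtimes> h)"
    using assms o by (simp_all add: IHom_precomp_def Hom_iff)
qed

lemma Eval_IHom_precomp:
  assumes h: "h \<in> Hom C X Y" and Z: "Z \<in> Obj C" and k: "k \<in> Hom C A (IHom C Y Z)"
  shows "Eval C X Z \<cdot> ((IHom_precomp C h Z \<cdot> k) \<boxtimes> \<one> X)
    = (Eval C Y Z \<cdot> (k \<boxtimes> \<one> Y)) \<cdot> (\<one> A \<boxtimes> h)"
proof -
  have o: "X \<in> Obj C" "Y \<in> Obj C" "A \<in> Obj C" using Hom_Obj[OF h] Hom_Obj[OF k] by auto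
  note p = IHom_precomp_Hom[OF h Z]
  have "Eval C X Z \<cdot> ((IHom_precomp C h Z \<cdot> k) \<boxtimes> \<one> X)
      = (Eval C X Z \<cdot> (IHom_precomp C h Z \<boxtimes> \<one> X)) \<cdot> (k \<boxtimes> \<one> X)"
    using o k Z p(1) by (simp add: Hom_iff)
  also have "\<dots> = (Eval C Y Z \<cdot> (k \<boxtimes> \<one> Y)) \<cdot> (\<one> A \<boxtimes> h)"
    unfolding p(2) using o k h Z by (simp add: Hom_iff)
  finally show ?thesis .
qed

text \<open>
  By the adjunction, precomposition with \<open>A \<otimes> h\<close> on morphisms into \<open>Z\<close> corresponds to
  postcomposition with \<open>h\<^sup>*\<close> on morphisms out of \<open>A\<close>. The statement is therefore the Yoneda
  lemma: \<open>h\<^sup>*\<close> is invertible iff it induces bijections on morphisms out of every \<open>A\<close>.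
\<close>

lemma local_objects_iff_orthogonal:
  assumes h: "h \<in> Hom C X Y"
  shows "Z \<in> local_objects C h \<longleftrightarrow> orthogonal C h Z"
proof
  have o: "X \<in> Obj C" "Y \<in> Obj C" using Hom_Obj[OF h] .
  have XY: "Dom C h = X" "Cod C h = Y" using h by (auto simp: Hom_iff)
  {
    assume L: "Z \<in> local_objects C h"
    then have Z: "Z \<in> Obj C" by (simp add: local_objects_def)
    have iso: "is_iso C (IHom C Y Z) (IHom C X Z) (IHom_precomp C h Z)"
      using L by (simp add: local_objects_def XY)
    then obtain q where q: "q \<in> Hom C (IHom C X Z) (IHom C Y Z)"
        "IHom_precomp C h Z \<cdot> q = \<one> (IHom C X Z)"
      by (elim is_isoE)
    note p = IHom_precomp_Hom(1)[OF h Z]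
    have "\<exists>!g. g \<in> Hom C (A \<otimes> Y) Z \<and> g \<cdot> (\<one> A \<boxtimes> h) = f"
      if A: "A \<in> Obj C" and f: "f \<in> Hom C (A \<otimes> X) Z" for A f
    proof (rule ex_ex1I)
      note c = Curry_transpose[OF A o(1) f]
      let ?k = "q \<cdot> Curry C A X Z f"
      have k: "?k \<in> Hom C A (IHom C Y Z)" using q(1) c(1) by (rule Comp_Hom[rotated])
      have "IHom_precomp C h Z \<cdot> ?k = (IHom_precomp C h Z \<cdot> q) \<cdot> Curry C A X Z f"
        using p q(1) c(1) by (simp add: Hom_iff)
      also have "\<dots> = Curry C A X Z f" unfolding q(2) using c(1) by (simp add: Hom_iff)
      finally have "(Eval C Y Z \<cdot> (?k \<boxtimes> \<one> Y)) \<cdot> (\<one> A \<boxtimes> h) = f"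
        using Eval_IHom_precomp[OF h Z k] c(2) by simp
      moreover have "Eval C Y Z \<cdot> (?k \<boxtimes> \<one> Y) \<in> Hom C (A \<otimes> Y) Z"
        using Z o A q(1) c(1) by (simp add: Hom_iff)
      ultimately show "\<exists>g. g \<in> Hom C (A \<otimes> Y) Z \<and> g \<cdot> (\<one> A \<boxtimes> h) = f" by blast
    next
      fix g g'
      assume g: "g \<in> Hom C (A \<otimes> Y) Z \<and> g \<cdot> (\<one> A \<boxtimes> h) = f"
        and g': "g' \<in> Hom C (A \<otimes> Y) Z \<and> g' \<cdot> (\<one> A \<boxtimes> h) = f"
      note c = Curry_transpose[OF A o(2) conjunct1[OF g]] and c' = Curry_transpose[OF A o(2) conjunct1[OF g']]
      have "IHom_precomp C h Z \<cdot> Curry C A Y Z g = IHom_precomp C h Z \<cdot> Curry C A Y Z g'"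
      proof (rule Eval_cancel[OF o(1) Z])
        show "Eval C X Z \<cdot> ((IHom_precomp C h Z \<cdot> Curry C A Y Z g) \<boxtimes> \<one> X)
            = Eval C X Z \<cdot> ((IHom_precomp C h Z \<cdot> Curry C A Y Z g') \<boxtimes> \<one> X)"
          unfolding Eval_IHom_precomp[OF h Z c(1)] Eval_IHom_precomp[OF h Z c'(1)] c(2) c'(2)
          using g g' by simp
      qed (use c(1) c'(1) p in \<open>simp_all add: Hom_iff\<close>)
      then have "Curry C A Y Z g = Curry C A Y Z g'"
        by (rule iso_cancel_left[OF iso c(1) c'(1)])
      then show "g = g'" using c(2) c'(2) by metis
    qed
    then show "orthogonal C h Z" using Z by (simp add: orthogonal_def XY)
  }
  assume orth: "orthogonal C h Z"
  then have Z: "Z \<in> Obj C" by (simp add: orthogonal_def)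
  let ?p = "IHom_precomp C h Z"
  note p = IHom_precomp_Hom(1)[OF h Z]
  have uniq: "\<exists>!g. g \<in> Hom C (A \<otimes> Y) Z \<and> g \<cdot> (\<one> A \<boxtimes> h) = f"
    if "f \<in> Hom C (A \<otimes> X) Z" "A \<in> Obj C" for A f
    using orth that by (simp add: orthogonal_def XY)
  obtain e where e: "e \<in> Hom C (IHom C X Z \<otimes> Y) Z" "e \<cdot> (\<one> (IHom C X Z) \<boxtimes> h) = Eval C X Z"
    using uniq[OF Eval_Hom[OF o(1) Z] IHom_Obj[OF o(1) Z]] by blast
  define q where "q = Curry C (IHom C X Z) Y Z e"
  have q: "q \<in> Hom C (IHom C X Z) (IHom C Y Z)" "Eval C Y Z \<cdot> (q \<boxtimes> \<one> Y) = e"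
    unfolding q_def using Curry_transpose[OF _ o(2) e(1)] o Z by simp_all
  have pq: "?p \<cdot> q = \<one> (IHom C X Z)"
  proof (rule Eval_cancel[OF o(1) Z])
    show "Eval C X Z \<cdot> ((?p \<cdot> q) \<boxtimes> \<one> X) = Eval C X Z \<cdot> (\<one> (IHom C X Z) \<boxtimes> \<one> X)"
      unfolding Eval_IHom_precomp[OF h Z q(1)] q(2) e(2) using o Z by simp
  qed (use p q(1) o Z in \<open>simp_all add: Hom_iff\<close>)
  have qp: "q \<cdot> ?p = \<one> (IHom C Y Z)"
  proof (rule Eval_cancel[OF o(2) Z])
    let ?g = "Eval C Y Z \<cdot> ((q \<cdot> ?p) \<boxtimes> \<one> Y)"
    have k: "q \<cdot> ?p \<in> Hom C (IHom C Y Z) (IHom C Y Z)" using p q(1) by (rule Comp_Hom)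
    have "?p \<cdot> (q \<cdot> ?p) = (?p \<cdot> q) \<cdot> ?p" using p q(1) by (simp add: Hom_iff)
    also have "\<dots> = ?p" unfolding pq using p by (simp add: Hom_iff)
    finally have "?g \<cdot> (\<one> (IHom C Y Z) \<boxtimes> h) = Eval C Y Z \<cdot> (\<one> (IHom C Y Z) \<boxtimes> h)"
      using Eval_IHom_precomp[OF h Z k] IHom_precomp_Hom(2)[OF h Z] by simp
    moreover have "Eval C Y Z \<cdot> (\<one> (IHom C Y Z) \<boxtimes> h) \<in> Hom C (IHom C Y Z \<otimes> X) Z"
      using o Z h by (simp add: Hom_iff)
    moreover have "?g \<in> Hom C (IHom C Y Z \<otimes> Y) Z"
      using o Z p q(1) by (simp add: Hom_iff)
    ultimately have "?g = Eval C Y Z"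
      using uniq[of "Eval C Y Z \<cdot> (\<one> (IHom C Y Z) \<boxtimes> h)" "IHom C Y Z"] Eval_Hom[OF o(2) Z] o Z
        IHom_Obj by blast
    then show "?g = Eval C Y Z \<cdot> (\<one> (IHom C Y Z) \<boxtimes> \<one> Y)" using o Z by simp
  qed (use p q(1) o Z in \<open>simp_all add: Hom_iff\<close>)
  show "Z \<in> local_objects C h"
    unfolding local_objects_def is_iso_def XY using Z p q(1) pq qp by blast
qed

end


section \<open>Modules over a solid monoid\<close>

locale closed_solid_monoid =
  closed_symmetric_monoidal_category C + solid_monoid_in C R \<mu> \<eta>
  for C :: "('o, 'a, 'm) closed_sym_monoidal_cat_scheme" (structure)
    and R :: 'o and \<mu> :: 'a and \<eta> :: 'a
begin

declare R_Obj [simp]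

lemma unit_arr [simp]: "\<eta> \<in> Arr C" "Dom C \<eta> = \<I>" "Cod C \<eta> = R"
  using unit_Hom by (auto simp: Hom_iff)

lemma mult_arr [simp]: "\<mu> \<in> Arr C" "Dom C \<mu> = R \<otimes> R" "Cod C \<mu> = R"
  using mult_Hom by (auto simp: Hom_iff)

text \<open>
  The only consequence of solidity in the proof. Both \<open>\<eta> \<otimes> R\<close> and \<open>R \<otimes> \<eta>\<close> are sections of
  \<open>\<mu>\<close> up to unitors; as \<open>\<mu>\<close> is monic, they agree up to unitors.
\<close>

lemma unit_right_via_unit_left:
  obtains t where "t \<in> Hom C (R \<otimes> \<I>) (\<I> \<otimes> R)" "\<one> R \<boxtimes> \<eta> = (\<eta> \<boxtimes> \<one> R) \<cdot> t"
proof -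
  obtain l where l: "l \<in> Hom C R (\<I> \<otimes> R)" "LUnit C R \<cdot> l = \<one> R"
    using LUnit_iso[OF R_Obj] by (elim is_isoE)
  have t: "l \<cdot> RUnit C R \<in> Hom C (R \<otimes> \<I>) (\<I> \<otimes> R)" using l(1) by (simp add: Hom_iff)
  have "\<mu> \<cdot> ((\<eta> \<boxtimes> \<one> R) \<cdot> (l \<cdot> RUnit C R)) = (\<mu> \<cdot> (\<eta> \<boxtimes> \<one> R)) \<cdot> (l \<cdot> RUnit C R)"
    using l(1) by (simp add: Hom_iff)
  also have "\<dots> = (LUnit C R \<cdot> l) \<cdot> RUnit C R"
    unfolding mult_unit_left using l(1) by (simp add: Hom_iff)
  also have "\<dots> = \<mu> \<cdot> (\<one> R \<boxtimes> \<eta>)"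
    unfolding l(2) mult_unit_right by simp
  finally have "(\<eta> \<boxtimes> \<one> R) \<cdot> (l \<cdot> RUnit C R) = \<one> R \<boxtimes> \<eta>"
    by (rule iso_cancel_left[OF mult_iso, rotated 2]) (use l(1) in \<open>simp_all add: Hom_iff\<close>)
  with t show ?thesis using that by metis
qed

lemma unit_outer_via_inner:
  assumes A: "A \<in> Obj C"
  obtains k where "k \<in> Hom C ((A \<otimes> R) \<otimes> \<I>) ((A \<otimes> \<I>) \<otimes> R)"
    "\<one> (A \<otimes> R) \<boxtimes> \<eta> = ((\<one> A \<boxtimes> \<eta>) \<boxtimes> \<one> R) \<cdot> k"
proof -
  obtain t where t: "t \<in> Hom C (R \<otimes> \<I>) (\<I> \<otimes> R)" "\<one> R \<boxtimes> \<eta> = (\<eta> \<boxtimes> \<one> R) \<cdot> t"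
    by (rule unit_right_via_unit_left)
  obtain s where s: "s \<in> Hom C (A \<otimes> \<I> \<otimes> R) ((A \<otimes> \<I>) \<otimes> R)" "Assoc C A \<I> R \<cdot> s = \<one> (A \<otimes> \<I> \<otimes> R)"
    using Assoc_iso[OF A Unit_Obj R_Obj] by (elim is_isoE)
  let ?k = "s \<cdot> ((\<one> A \<boxtimes> t) \<cdot> Assoc C A R \<I>)"
  have k: "?k \<in> Hom C ((A \<otimes> R) \<otimes> \<I>) ((A \<otimes> \<I>) \<otimes> R)"
    using A t(1) s(1) by (simp add: Hom_iff)
  have "Assoc C A R R \<cdot> (\<one> (A \<otimes> R) \<boxtimes> \<eta>) = (\<one> A \<boxtimes> (\<one> R \<boxtimes> \<eta>)) \<cdot> Assoc C A R \<I>"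
    using Assoc_natural[of "\<one> A" A A "\<one> R" R R \<eta> \<I> R] A by (simp add: Hom_iff)
  also have "\<dots> = (\<one> A \<boxtimes> (\<eta> \<boxtimes> \<one> R)) \<cdot> ((Assoc C A \<I> R \<cdot> s) \<cdot> ((\<one> A \<boxtimes> t) \<cdot> Assoc C A R \<I>))"
    unfolding t(2) s(2) using A t(1) by (simp add: Hom_iff)
  also have "\<dots> = ((\<one> A \<boxtimes> (\<eta> \<boxtimes> \<one> R)) \<cdot> Assoc C A \<I> R) \<cdot> ?k"
    using A t(1) s(1) by (simp add: Hom_iff)
  also have "\<dots> = Assoc C A R R \<cdot> (((\<one> A \<boxtimes> \<eta>) \<boxtimes> \<one> R) \<cdot> ?k)"
    using Assoc_natural[of "\<one> A" A A \<eta> \<I> R "\<one> R" R R, symmetric] A t(1) s(1)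
    by (simp add: Hom_iff del: Tensor_Comp_arr)
  finally have "\<one> (A \<otimes> R) \<boxtimes> \<eta> = ((\<one> A \<boxtimes> \<eta>) \<boxtimes> \<one> R) \<cdot> ?k"
    by (rule iso_cancel_left[OF Assoc_iso, rotated -1]) (use A t(1) s(1) in \<open>simp_all add: Hom_iff\<close>)
  with k show ?thesis using that by blast
qed

text \<open>
  Extensions along \<open>A \<otimes> \<eta>\<close> exist because the action retracts \<open>\<eta> \<otimes> Z\<close> up to the unitor. For uniqueness, \<open>g\<close> is
  recovered from \<open>g \<otimes> R\<close> restricted along \<open>(A \<otimes> R) \<otimes> \<eta>\<close>, and by solidity this only involves the
  restriction of \<open>g\<close> along \<open>A \<otimes> \<eta>\<close>.
\<close>

lemma orthogonal_if_unital_action: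
  assumes Z: "Z \<in> Obj C" and a: "a \<in> Hom C (R \<otimes> Z) Z" and unital: "a \<cdot> (\<eta> \<boxtimes> \<one> Z) = LUnit C Z"
  shows "orthogonal C \<eta> Z"
proof -
  define b where "b = a \<cdot> Sym C Z R"
  have b: "b \<in> Arr C" "Dom C b = Z \<otimes> R" "Cod C b = Z"
    using a Z by (simp_all add: b_def Hom_iff)
  have "b \<cdot> (\<one> Z \<boxtimes> \<eta>) = (a \<cdot> (\<eta> \<boxtimes> \<one> Z)) \<cdot> Sym C Z \<I>"
    using a Z Sym_natural[OF Ident_Hom[OF Z] unit_Hom] by (simp add: b_def Hom_iff)
  then have bZ: "b \<cdot> (\<one> Z \<boxtimes> \<eta>) = SUnit Z"
    unfolding unital SUnit_def .
  have b_ext: "b \<cdot> (f \<boxtimes> \<eta>) = f \<cdot> SUnit B" if f: "f \<in> Hom C B Z" for f B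
  proof -
    have "b \<cdot> (f \<boxtimes> \<eta>) = (b \<cdot> (\<one> Z \<boxtimes> \<eta>)) \<cdot> (f \<boxtimes> \<one> \<I>)"
      using b f Z by (simp add: Hom_iff)
    also have "\<dots> = f \<cdot> SUnit B" unfolding bZ by (rule SUnit_natural[OF f])
    finally show ?thesis .
  qed
  have "\<exists>!g. g \<in> Hom C (A \<otimes> R) Z \<and> g \<cdot> (\<one> A \<boxtimes> \<eta>) = f"
    if A: "A \<in> Obj C" and f: "f \<in> Hom C (A \<otimes> \<I>) Z" for A f
  proof (rule ex_ex1I)
    obtain u where u: "u \<in> Hom C A (A \<otimes> \<I>)" "u \<cdot> SUnit A = \<one> (A \<otimes> \<I>)"
      using SUnit_iso[OF A] by (elim is_isoE)
    have fu: "f \<cdot> u \<in> Hom C A Z" using u(1) f by (rule Comp_Hom)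
    let ?g = "b \<cdot> ((f \<cdot> u) \<boxtimes> \<one> R)"
    have "?g \<cdot> (\<one> A \<boxtimes> \<eta>) = b \<cdot> ((f \<cdot> u) \<boxtimes> \<eta>)"
      using b f u(1) A by (simp add: Hom_iff)
    also have "\<dots> = f \<cdot> (u \<cdot> SUnit A)"
      unfolding b_ext[OF fu] using f u(1) A by (simp add: Hom_iff)
    also have "\<dots> = f" unfolding u(2) using f by (simp add: Hom_iff)
    finally have "?g \<cdot> (\<one> A \<boxtimes> \<eta>) = f" .
    moreover have "?g \<in> Hom C (A \<otimes> R) Z" using b f u(1) A by (simp add: Hom_iff)
    ultimately show "\<exists>g. g \<in> Hom C (A \<otimes> R) Z \<and> g \<cdot> (\<one> A \<boxtimes> \<eta>) = f" by blast
  next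
    obtain k where k: "k \<in> Hom C ((A \<otimes> R) \<otimes> \<I>) ((A \<otimes> \<I>) \<otimes> R)"
      "\<one> (A \<otimes> R) \<boxtimes> \<eta> = ((\<one> A \<boxtimes> \<eta>) \<boxtimes> \<one> R) \<cdot> k"
      using unit_outer_via_inner[OF A] by blast
    have recover: "g \<cdot> SUnit (A \<otimes> R) = b \<cdot> (((g \<cdot> (\<one> A \<boxtimes> \<eta>)) \<boxtimes> \<one> R) \<cdot> k)"
      if g: "g \<in> Hom C (A \<otimes> R) Z" for g
    proof -
      have "g \<cdot> SUnit (A \<otimes> R) = b \<cdot> ((g \<boxtimes> \<one> R) \<cdot> (\<one> (A \<otimes> R) \<boxtimes> \<eta>))"
        using b_ext[OF g] g A by (simp add: Hom_iff)
      also have "\<dots> = b \<cdot> (((g \<cdot> (\<one> A \<boxtimes> \<eta>)) \<boxtimes> \<one> R) \<cdot> k)"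
        unfolding k(2) using b g A k(1) by (simp add: Hom_iff)
      finally show ?thesis .
    qed
    fix g g'
    assume "g \<in> Hom C (A \<otimes> R) Z \<and> g \<cdot> (\<one> A \<boxtimes> \<eta>) = f"
      and "g' \<in> Hom C (A \<otimes> R) Z \<and> g' \<cdot> (\<one> A \<boxtimes> \<eta>) = f"
    then show "g = g'"
      using recover A by (intro iso_cancel_right[OF SUnit_iso, of "A \<otimes> R" g Z g']) auto
  qed
  then show ?thesis using Z by (simp add: orthogonal_def)
qed

lemma orthogonal_cancel:
  assumes orth: "orthogonal C \<eta> Z" and A: "A \<in> Obj C"
    and g: "g \<in> Hom C (R \<otimes> A) Z" "g' \<in> Hom C (R \<otimes> A) Z"
    and eq: "g \<cdot> (\<eta> \<boxtimes> \<one> A) = g' \<cdot> (\<eta> \<boxtimes> \<one> A)"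
  shows "g = g'"
proof -
  have sym: "(e \<cdot> Sym C A R) \<cdot> (\<one> A \<boxtimes> \<eta>) = (e \<cdot> (\<eta> \<boxtimes> \<one> A)) \<cdot> Sym C A \<I>"
    if "e \<in> Hom C (R \<otimes> A) Z" for e
    using that A Sym_natural[OF Ident_Hom[OF A] unit_Hom] by (simp add: Hom_iff)
  have "(g \<cdot> Sym C A R) \<cdot> (\<one> A \<boxtimes> \<eta>) \<in> Hom C (A \<otimes> \<I>) Z"
    using g(1) A by (simp add: Hom_iff)
  with orth A have "\<exists>!e. e \<in> Hom C (A \<otimes> R) Z \<and> e \<cdot> (\<one> A \<boxtimes> \<eta>) = (g \<cdot> Sym C A R) \<cdot> (\<one> A \<boxtimes> \<eta>)"
    by (simp add: orthogonal_def)
  moreover have "(g' \<cdot> Sym C A R) \<cdot> (\<one> A \<boxtimes> \<eta>) = (g \<cdot> Sym C A R) \<cdot> (\<one> A \<boxtimes> \<eta>)"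
    unfolding sym[OF g(1)] sym[OF g(2)] eq ..
  moreover have "g \<cdot> Sym C A R \<in> Hom C (A \<otimes> R) Z" "g' \<cdot> Sym C A R \<in> Hom C (A \<otimes> R) Z"
    using g A by (simp_all add: Hom_iff)
  ultimately have "g \<cdot> Sym C A R = g' \<cdot> Sym C A R" by blast
  then show ?thesis
    by (rule iso_cancel_right[OF Sym_iso[OF A R_Obj] g])
qed

text \<open>
  Extending \<open>LUnit Z\<close> along \<open>\<eta> \<otimes> Z\<close> gives the action. Both sides of the associativity law are then
  morphisms out of \<open>R \<otimes> (R \<otimes> Z)\<close>, so it suffices to compare them along \<open>\<eta> \<otimes> (R \<otimes> Z)\<close>, where
  they agree by unitality of \<open>\<mu>\<close> and of the action.
\<close>

lemma orthogonal_imp_action: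
  assumes orth: "orthogonal C \<eta> Z"
  obtains a where "(Z, a) \<in> Modules C R \<mu> \<eta>"
proof -
  have Z: "Z \<in> Obj C" using orth by (simp add: orthogonal_def)
  have "SUnit Z \<in> Hom C (Z \<otimes> \<I>) Z" using Z by (simp add: Hom_iff)
  with orth Z have "\<exists>!b. b \<in> Hom C (Z \<otimes> R) Z \<and> b \<cdot> (\<one> Z \<boxtimes> \<eta>) = SUnit Z"
    by (simp add: orthogonal_def)
  then obtain b where b: "b \<in> Hom C (Z \<otimes> R) Z" "b \<cdot> (\<one> Z \<boxtimes> \<eta>) = SUnit Z" by blast
  define a where "a = b \<cdot> Sym C R Z"
  have a: "a \<in> Hom C (R \<otimes> Z) Z" using b(1) Z by (simp add: a_def Hom_iff)
  have "a \<cdot> (\<eta> \<boxtimes> \<one> Z) = (b \<cdot> (\<one> Z \<boxtimes> \<eta>)) \<cdot> Sym C \<I> Z"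
    using b(1) Z Sym_natural[OF unit_Hom Ident_Hom[OF Z]] by (simp add: a_def Hom_iff)
  also have "\<dots> = LUnit C Z"
    unfolding b(2) SUnit_def using Z Sym_Sym[of \<I> Z] by simp
  finally have unital: "a \<cdot> (\<eta> \<boxtimes> \<one> Z) = LUnit C Z" .
  obtain s where s: "s \<in> Hom C (R \<otimes> R \<otimes> Z) ((R \<otimes> R) \<otimes> Z)"
      "s \<cdot> Assoc C R R Z = \<one> ((R \<otimes> R) \<otimes> Z)" "Assoc C R R Z \<cdot> s = \<one> (R \<otimes> R \<otimes> Z)"
    using Assoc_iso[OF R_Obj R_Obj Z] by (elim is_isoE)
  have "(a \<cdot> (\<mu> \<boxtimes> \<one> Z)) \<cdot> s = a \<cdot> (\<one> R \<boxtimes> a)"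
  proof (rule orthogonal_cancel[OF orth])
    have nat: "Assoc C R R Z \<cdot> ((\<eta> \<boxtimes> \<one> R) \<boxtimes> \<one> Z) = (\<eta> \<boxtimes> \<one> (R \<otimes> Z)) \<cdot> Assoc C \<I> R Z"
      using Z Assoc_natural[OF unit_Hom Ident_Hom[OF R_Obj] Ident_Hom[OF Z]] by simp
    have "(((a \<cdot> (\<mu> \<boxtimes> \<one> Z)) \<cdot> s) \<cdot> (\<eta> \<boxtimes> \<one> (R \<otimes> Z))) \<cdot> Assoc C \<I> R Z
        = (a \<cdot> (\<mu> \<boxtimes> \<one> Z)) \<cdot> (s \<cdot> ((\<eta> \<boxtimes> \<one> (R \<otimes> Z)) \<cdot> Assoc C \<I> R Z))"
      using a Z s(1) by (simp add: Hom_iff)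
    also have "\<dots> = (a \<cdot> (\<mu> \<boxtimes> \<one> Z)) \<cdot> ((s \<cdot> Assoc C R R Z) \<cdot> ((\<eta> \<boxtimes> \<one> R) \<boxtimes> \<one> Z))"
      unfolding nat[symmetric] using a Z s(1) by (simp add: Hom_iff)
    also have "\<dots> = a \<cdot> ((\<mu> \<cdot> (\<eta> \<boxtimes> \<one> R)) \<boxtimes> \<one> Z)"
      unfolding s(2) using a Z by (simp add: Hom_iff)
    also have "\<dots> = a \<cdot> (LUnit C (R \<otimes> Z) \<cdot> Assoc C \<I> R Z)"
      unfolding mult_unit_left LUnit_Tensor[OF R_Obj Z] ..
    also have "\<dots> = (LUnit C Z \<cdot> (\<one> \<I> \<boxtimes> a)) \<cdot> Assoc C \<I> R Z"
      unfolding LUnit_natural[OF a] using a Z by (simp add: Hom_iff)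
    also have "\<dots> = ((a \<cdot> (\<one> R \<boxtimes> a)) \<cdot> (\<eta> \<boxtimes> \<one> (R \<otimes> Z))) \<cdot> Assoc C \<I> R Z"
      unfolding unital[symmetric] using a Z by (simp add: Hom_iff)
    finally show "((a \<cdot> (\<mu> \<boxtimes> \<one> Z)) \<cdot> s) \<cdot> (\<eta> \<boxtimes> \<one> (R \<otimes> Z))
        = (a \<cdot> (\<one> R \<boxtimes> a)) \<cdot> (\<eta> \<boxtimes> \<one> (R \<otimes> Z))"
      by (rule iso_cancel_right[OF Assoc_iso, rotated -1]) (use a Z s(1) in \<open>simp_all add: Hom_iff\<close>)
  qed (use a Z s(1) in \<open>simp_all add: Hom_iff\<close>)
  then have "((a \<cdot> (\<mu> \<boxtimes> \<one> Z)) \<cdot> s) \<cdot> Assoc C R R Z = (a \<cdot> (\<one> R \<boxtimes> a)) \<cdot> Assoc C R R Z"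
    by simp
  then have "a \<cdot> (\<mu> \<boxtimes> \<one> Z) = (a \<cdot> (\<one> R \<boxtimes> a)) \<cdot> Assoc C R R Z"
    using a Z s(1,2) by (simp add: Hom_iff)
  then have "(Z, a) \<in> Modules C R \<mu> \<eta>"
    using Z a unital by (simp add: Modules_def)
  then show ?thesis using that by blast
qed

lemma Modules_orthogonal: "M \<in> Modules C R \<mu> \<eta> \<Longrightarrow> orthogonal C \<eta> (fst M)"
  by (auto simp: Modules_def intro: orthogonal_if_unital_action)

text \<open>
  The two sides of the linearity condition agree along \<open>\<eta> \<otimes> M\<close> by unitality and naturality of the
  left unitor, hence agree because the target is orthogonal to \<open>\<eta>\<close>.
\<close>

lemma module_hom_iff_Hom:
  assumes M: "M \<in> Modules C R \<mu> \<eta>" and N: "N \<in> Modules C R \<mu> \<eta>"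
  shows "module_hom C R M N f \<longleftrightarrow> f \<in> Hom C (fst M) (fst N)"
proof
  assume f: "f \<in> Hom C (fst M) (fst N)"
  obtain X a where X: "M = (X, a)" "X \<in> Obj C" "a \<in> Hom C (R \<otimes> X) X" "a \<cdot> (\<eta> \<boxtimes> \<one> X) = LUnit C X"
    using M by (auto simp: Modules_def)
  obtain Y b where Y: "N = (Y, b)" "Y \<in> Obj C" "b \<in> Hom C (R \<otimes> Y) Y" "b \<cdot> (\<eta> \<boxtimes> \<one> Y) = LUnit C Y"
    using N by (auto simp: Modules_def)
  have f: "f \<in> Hom C X Y" using f X(1) Y(1) by simp
  have "f \<cdot> a = b \<cdot> (\<one> R \<boxtimes> f)"
  proof (rule orthogonal_cancel)
    show "orthogonal C \<eta> Y" using Modules_orthogonal[OF N] Y(1) by simp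
    have "(f \<cdot> a) \<cdot> (\<eta> \<boxtimes> \<one> X) = f \<cdot> LUnit C X"
      unfolding X(4)[symmetric] using f X(2,3) by (simp add: Hom_iff)
    also have "\<dots> = (b \<cdot> (\<eta> \<boxtimes> \<one> Y)) \<cdot> (\<one> \<I> \<boxtimes> f)"
      unfolding Y(4) LUnit_natural[OF f] ..
    also have "\<dots> = (b \<cdot> (\<one> R \<boxtimes> f)) \<cdot> (\<eta> \<boxtimes> \<one> X)"
      using f X(2) Y(2,3) by (simp add: Hom_iff)
    finally show "(f \<cdot> a) \<cdot> (\<eta> \<boxtimes> \<one> X) = (b \<cdot> (\<one> R \<boxtimes> f)) \<cdot> (\<eta> \<boxtimes> \<one> X)" .
  qed (use f X(2,3) Y(2,3) in \<open>simp_all add: Hom_iff\<close>)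
  then show "module_hom C R M N f" using f X(1) Y(1) by (simp add: module_hom_def)
qed (simp add: module_hom_def)

lemma local_objects_eq_carriers: "local_objects C \<eta> = fst ` Modules C R \<mu> \<eta>"
proof (rule set_eqI)
  fix Z
  have "Z \<in> local_objects C \<eta> \<longleftrightarrow> orthogonal C \<eta> Z"
    by (rule local_objects_iff_orthogonal[OF unit_Hom])
  also have "\<dots> \<longleftrightarrow> Z \<in> fst ` Modules C R \<mu> \<eta>"
    using Modules_orthogonal orthogonal_imp_action by (metis (no_types, lifting) fst_conv image_iff)
  finally show "Z \<in> local_objects C \<eta> \<longleftrightarrow> Z \<in> fst ` Modules C R \<mu> \<eta>" .
qed

lemma Modules_Obj: "M \<in> Modules C R \<mu> \<eta> \<Longrightarrow> fst M \<in> Obj C"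
  by (auto simp: Modules_def)

lemma Hom_module_category:
  "F \<in> Hom (module_category C R \<mu> \<eta>) M N \<longleftrightarrow>
    M \<in> Modules C R \<mu> \<eta> \<and> N \<in> Modules C R \<mu> \<eta> \<and> (\<exists>f \<in> Hom C (fst M) (fst N). F = (M, f, N))"
proof -
  have *: "F \<in> Hom (module_category C R \<mu> \<eta>) M N \<longleftrightarrow>
      M \<in> Modules C R \<mu> \<eta> \<and> N \<in> Modules C R \<mu> \<eta> \<and> (\<exists>f. module_hom C R M N f \<and> F = (M, f, N))"
    by (cases F rule: prod_cases3) (simp add: Hom_def module_category_def, blast)
  show ?thesis
    unfolding * by (simp add: module_hom_iff_Hom Bex_def cong: conj_cong)
qed

lemma module_category_simps [simp]:
  "Obj (module_category C R \<mu> \<eta>) = Modules C R \<mu> \<eta>"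
  "Ident (module_category C R \<mu> \<eta>) M = (M, \<one> (fst M), M)"
  "Comp (module_category C R \<mu> \<eta>) (N, g, P) (M, f, N') = (M, g \<cdot> f, P)"
  by (simp_all add: module_category_def)

lemma category_module_category: "category (module_category C R \<mu> \<eta>)"
proof
  fix F assume F: "F \<in> Arr (module_category C R \<mu> \<eta>)"
  then show "Dom (module_category C R \<mu> \<eta>) F \<in> Obj (module_category C R \<mu> \<eta>)"
    and "Cod (module_category C R \<mu> \<eta>) F \<in> Obj (module_category C R \<mu> \<eta>)"
    by (auto simp: module_category_def)
next
  fix F G M N P
  assume "F \<in> Hom (module_category C R \<mu> \<eta>) M N" "G \<in> Hom (module_category C R \<mu> \<eta>) N P"
  then show "Comp (module_category C R \<mu> \<eta>) G F \<in> Hom (module_category C R \<mu> \<eta>) M P"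
    by (auto simp: Hom_module_category dest: Comp_Hom)
next
  fix F G H M N P Q
  assume "F \<in> Hom (module_category C R \<mu> \<eta>) M N" "G \<in> Hom (module_category C R \<mu> \<eta>) N P"
    "H \<in> Hom (module_category C R \<mu> \<eta>) P Q"
  then show "Comp (module_category C R \<mu> \<eta>) (Comp (module_category C R \<mu> \<eta>) H G) F
      = Comp (module_category C R \<mu> \<eta>) H (Comp (module_category C R \<mu> \<eta>) G F)"
    unfolding Hom_module_category by (elim conjE bexE) (simp add: Comp_assoc)
qed (auto simp: Hom_module_category Modules_Obj Ident_Hom Comp_Ident Ident_Comp)

text \<open>
  Any choice of actions on the local objects gives an inverse of the forgetful functor. A local object is returned unchanged, and a
  module is sent to the module with the same carrier and the chosen action; the identity of the
  carrier is linear between the two.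
\<close>

lemma equivalent_categories_modules_local:
  "equivalent_categories (module_category C R \<mu> \<eta>) (full_subcategory C (local_objects C \<eta>))"
    (is "equivalent_categories ?M ?L")
proof -
  define act where "act Z = (SOME a. (Z, a) \<in> Modules C R \<mu> \<eta>)" for Z
  define G where "G Z = (Z, act Z)" for Z
  have G: "G Z \<in> Modules C R \<mu> \<eta>" if "Z \<in> local_objects C \<eta>" for Z
    using that unfolding local_objects_eq_carriers G_def act_def by (force intro: someI)
  have fstG [simp]: "fst (G Z) = Z" for Z by (simp add: G_def)
  have LI: "fst M \<in> local_objects C \<eta>" if "M \<in> Modules C R \<mu> \<eta>" for M
    using that unfolding local_objects_eq_carriers by simp
  have L: "Obj ?L = Obj C \<inter> local_objects C \<eta>" "Ident ?L = Ident C" "Comp ?L = Comp C"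
    by (simp_all add: full_subcategory_def)
  have HL: "f \<in> Hom ?L X Y \<longleftrightarrow> f \<in> Hom C X Y \<and> X \<in> local_objects C \<eta> \<and> Y \<in> local_objects C \<eta>" for f X Y
    by (auto simp: full_subcategory_def Hom_def)
  let ?F = "fst \<circ> snd" and ?G = "\<lambda>f. (G (Dom C f), f, G (Cod C f))"
  have F_functor: "is_functor ?M ?L fst ?F"
    by unfold_locales (auto simp: L HL LI Hom_module_category Modules_Obj)
  have G_functor: "is_functor ?L ?M G ?G"
    by unfold_locales (auto simp: L HL G Hom_module_category Hom_iff)
  let ?u = "\<lambda>M. (M, \<one> (fst M), G (fst M))"
  have u_iso: "is_iso ?M M (G (fst M)) (?u M)" if M: "M \<in> Modules C R \<mu> \<eta>" for M
    unfolding is_iso_def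
  proof (intro conjI bexI)
    show "?u M \<in> Hom ?M M (G (fst M))" "(G (fst M), \<one> (fst M), M) \<in> Hom ?M (G (fst M)) M"
      using M by (simp_all add: Hom_module_category G LI Ident_Hom Modules_Obj)
  qed (use Modules_Obj[OF M] in simp_all)
  have u: "natural_iso ?M ?M id id (G \<circ> fst) (?G \<circ> ?F) ?u"
    unfolding natural_iso_def using u_iso by (auto simp: Hom_module_category Hom_iff)
  have v: "natural_iso ?L ?L (fst \<circ> G) (?F \<circ> ?G) id id (Ident C)"
    unfolding natural_iso_def is_iso_def
    by (auto simp: L HL Ident_Hom Comp_Ident Ident_Comp)
  show ?thesis
    unfolding equivalent_categories_def
    using category_module_category category_full_subcategory F_functor G_functor u v by blast
qed

end

theorem mainTheorem3:
  fixes E :: "('o, 'a, 'm) closed_sym_monoidal_cat_scheme"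
    and R :: 'o and \<mu> \<eta> :: 'a
  assumes "closed_symmetric_monoidal_category E"
    and "cocomplete TYPE('u) E"
    and "solid_monoid_in E R \<mu> \<eta>"
  shows "equivalent_categories (module_category E R \<mu> \<eta>)
           (full_subcategory E (local_objects E \<eta>))"
proof -
  interpret closed_solid_monoid E R \<mu> \<eta>
    using assms(1,3) by (rule closed_solid_monoid.intro)
  show ?thesis by (rule equivalent_categories_modules_local)
qed

end
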